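(* Let $G=(V,E)$ be a finite connected simple graph with $n=|V|\ge2$ and maximum degree $\Delta$. Let $p\in(1,\infty]$ and let $f_0:V\to\mathbb{R}$ be nonconstant. Set $$R=\operatorname{osc}(f_0),\qquad \psi=\lVert Sf_0-f_0\rVert_\infty.$$ Then $\psi>0$, and for every $0<\epsilon\le R/2$, $$\mathbb{E}\,\tau_p(\epsilon;f_0)\ \ge\ \frac{1}{64e}\,\frac{nR}{\Delta\psi}.$$
   Context: For a nonempty vector $y=(y_1,\dots,y_k)$: if $1<p<\infty$, $m_p(y)$ is the unique minimizer over $x\in\mathbb{R}$ of $\sum_{i=1}^k|x-y_i|^p$; if $p=\infty$, $m_\infty(y)=\frac12(\max_iy_i+\min_iy_i)$. For a profile $f:V\to\mathbb{R}$ and $u\in V$, $f^{\#u}$ is the profile equal to $m_p((f(v))_{v\sim u})$ at $u$ and equal to $f$ at every other vertex; the synchronous update $Sf$ is defined by $(Sf)(u)=m_p((f(v))_{v\sim u})$ for every $u\in V$. Let $U_1,U_2,\ldots$ be independent uniformly distributed vertices of $V$; starting from the deterministic profile $f_0$ set $f_t=f_{t-1}^{\#U_t}$ for $t\ge1$. Let $\operatorname{osc}(f)=\max_V f-\min_V f$ and $\tau_p(\epsilon;f_0)=\min\{t\ge0:\operatorname{osc}(f_t)\le\epsilon\}$ (equal to $\infty$ if the set is empty). $\mathbb{E}$ is expectation over $(U_t)$. *)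

theory Defs
  imports "Graph_Theory.Digraph_Component" "HOL-Probability.Probability"
begin

text \<open>
  A finite simple graph is a \<open>pair_graph\<close>: a finite vertex set with a symmetric irreflexive
  set of arcs, each undirected edge being represented by its two orientations. Profiles are functions
  on the whole vertex type; only their values on \<open>pverts G\<close> are ever used.
\<close>

definition nbrs :: "'a pair_pre_digraph \<Rightarrow> 'a \<Rightarrow> 'a set" where
  "nbrs G u = {v. (u, v) \<in> parcs G}"

text \<open>In a symmetric digraph the out-degree of a vertex is its number of neighbours.\<close>

definition max_degree :: "'a pair_pre_digraph \<Rightarrow> nat" where
  "max_degree G = Max (out_degree (with_proj G) ` pverts G)"

text \<open>
  The vector is given as a family \<open>y\<close> over a finite nonempty index set \<open>I\<close>, so repeated values
  count with multiplicity. For \<open>1 < p < \<infinity>\<close> the minimizer exists and is unique by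
  strict convexity and coercivity, so the description is proper; other values of \<open>p\<close> are not used.
\<close>

definition p_mean :: "ereal \<Rightarrow> 'i set \<Rightarrow> ('i \<Rightarrow> real) \<Rightarrow> real" where
  "p_mean p I y =
     (if p = \<infinity> then (Max (y ` I) + Min (y ` I)) / 2
      else (THE x. is_arg_min (\<lambda>x. \<Sum>i\<in>I. \<bar>x - y i\<bar> powr real_of_ereal p) (\<lambda>_. True) x))"

definition sync_update :: "'a pair_pre_digraph \<Rightarrow> ereal \<Rightarrow> ('a \<Rightarrow> real) \<Rightarrow> 'a \<Rightarrow> real" where
  "sync_update G p f = (\<lambda>u. p_mean p (nbrs G u) f)"

definition vertex_update :: "'a pair_pre_digraph \<Rightarrow> ereal \<Rightarrow> ('a \<Rightarrow> real) \<Rightarrow> 'a \<Rightarrow> 'a \<Rightarrow> real" where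
  "vertex_update G p f u = f(u := p_mean p (nbrs G u) f)"

text \<open>\<open>w t\<close> is the vertex updated at time \<open>t \<ge> 1\<close>; \<open>w 0\<close> is not used.\<close>

primrec trajectory ::
  "'a pair_pre_digraph \<Rightarrow> ereal \<Rightarrow> ('a \<Rightarrow> real) \<Rightarrow> (nat \<Rightarrow> 'a) \<Rightarrow> nat \<Rightarrow> 'a \<Rightarrow> real" where
  "trajectory G p f0 w 0 = f0"
| "trajectory G p f0 w (Suc t) = vertex_update G p (trajectory G p f0 w t) (w (Suc t))"

definition osc :: "'a set \<Rightarrow> ('a \<Rightarrow> real) \<Rightarrow> real" where
  "osc V f = Max (f ` V) - Min (f ` V)"

definition sup_norm :: "'a set \<Rightarrow> ('a \<Rightarrow> real) \<Rightarrow> real" where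
  "sup_norm V f = Max ((\<lambda>u. \<bar>f u\<bar>) ` V)"

definition hit_time ::
  "'a pair_pre_digraph \<Rightarrow> ereal \<Rightarrow> real \<Rightarrow> ('a \<Rightarrow> real) \<Rightarrow> (nat \<Rightarrow> 'a) \<Rightarrow> enat" where
  "hit_time G p \<epsilon> f0 w =
     (if \<exists>t. osc (pverts G) (trajectory G p f0 w t) \<le> \<epsilon>
      then enat (LEAST t. osc (pverts G) (trajectory G p f0 w t) \<le> \<epsilon>) else \<infinity>)"

end

theory Submission
  imports Defs
begin

text \<open>
  The obstruction to fast convergence is that influence has to travel. Since the $p$-mean is monotone
  and commutes with adding constants, it is nonexpansive for the supremum norm (\<open>p_mean_nonexpansive\<close>).
  Hence, when \<open>u\<close> is updated, its displacement \<open>\<bar>f\<^sub>t(u) - f\<^sub>0(u)\<bar>\<close> is at most the largest current displacement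
  of a neighbour plus \<open>\<bar>(Sf\<^sub>0)(u) - f\<^sub>0(u)\<bar> \<le> \<psi>\<close>. Iterating, \<open>\<bar>f\<^sub>t(u) - f\<^sub>0(u)\<bar> \<le> \<psi> D\<^sub>t(u)\<close>, where the
  influence depth \<open>D\<^sub>t(u)\<close> is the largest number of vertices on a walk ending in \<open>u\<close> whose vertices were
  updated, in order, at increasing times up to \<open>t\<close> (\<open>displacement_le_depth\<close>). The depth no longer
  depends on \<open>p\<close> or on the profile.

  Let \<open>f\<^sub>0\<close> attain its maximum at \<open>a\<close> and its minimum at \<open>b\<close>. As long as \<open>D\<^sub>t(a)\<close> and \<open>D\<^sub>t(b)\<close> stay below
  \<open>R / (4 \<psi>)\<close>, both values move by less than \<open>R / 4\<close> and the oscillation exceeds \<open>R / 2 \<ge> \<epsilon>\<close>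
  (\<open>hit_time_gt\<close>). Watching only these two vertices avoids a union bound over all of \<open>V\<close>, which would cost
  a logarithm of \<open>n\<close>.

  A vertex is updated with probability \<open>1 / n\<close> in each step, and a new depth is one more than the depth
  of one of at most \<open>\<Delta>\<close> neighbours (or the old depth), so \<open>max\<^sub>u E x\<^bsup>D\<^sub>t(u)\<^esup>\<close> grows at most by the factor
  \<open>1 + x \<Delta> / n\<close> per step (\<open>expectation_power_depth_le\<close>). With \<open>x = 4 e\<close>, Markov's inequality shows that
  up to time \<open>k n / (4 e \<Delta>)\<close> a fixed vertex has depth at least \<open>k\<close> with probability
  at most \<open>4\<^bsup>-k\<^esup>\<close> (\<open>prob_depth_ge_le\<close>). For \<open>k = \<lceil>R / (4 \<psi>)\<rceil>\<close> both \<open>a\<close> and \<open>b\<close> have smaller depth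
  with probability at least \<open>1 / 2\<close>, which bounds the expectation from below.

  Positivity of \<open>\<psi>\<close> is the strong maximum principle: a $p$-mean equals an upper bound of its arguments
  only if all of them equal that bound, so a profile fixed by \<open>S\<close> on a connected graph is constant
  (\<open>harmonic_imp_constant\<close>).
\<close>

section \<open>The $p$-mean of a finite family\<close>

text \<open>
  This is \<open>sgn s * \<bar>s\<bar> powr q\<close>; for \<open>q = r - 1\<close> it is the derivative of \<open>\<bar>s\<bar> powr r\<close> up to the factor \<open>r\<close>.
  Splitting \<open>s\<close> into positive and negative part makes continuity at \<open>0\<close> immediate.
\<close>

definition signed_power :: "real \<Rightarrow> real \<Rightarrow> real" where
  "signed_power q s = (max s 0) powr q - (max (- s) 0) powr q"

lemma signed_power_0 [simp]: "signed_power q 0 = 0"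
  by (simp add: signed_power_def)

lemma signed_power_minus: "signed_power q (- s) = - signed_power q s"
  by (simp add: signed_power_def)

lemma strict_mono_signed_power:
  assumes "0 < q"
  shows "strict_mono (signed_power q)"
proof (rule strict_monoI)
  fix x y :: real
  assume "x < y"
  then consider "0 \<le> x" | "y \<le> 0" | "x < 0" "0 < y" by linarith
  then show "signed_power q x < signed_power q y"
  proof cases
    case 1
    with \<open>x < y\<close> assms show ?thesis
      by (simp add: signed_power_def max_def powr_less_mono2)
  next
    case 2
    with \<open>x < y\<close> assms show ?thesis
      by (simp add: signed_power_def max_def powr_less_mono2)
  next
    case 3
    then have "0 < y powr q" "0 < (- x) powr q" by auto
    moreover have "signed_power q x = - ((- x) powr q)" "signed_power q y = y powr q"
      using 3 by (simp_all add: signed_power_def max_def)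
    ultimately show ?thesis by linarith
  qed
qed

lemma continuous_on_signed_power [continuous_intros]:
  assumes "0 < q" "continuous_on A f"
  shows "continuous_on A (\<lambda>x. signed_power q (f x))"
  unfolding signed_power_def
  using assms by (intro continuous_intros continuous_on_powr') auto

text \<open>
  The graph of \<open>\<bar>s\<bar> powr r\<close> lies above its tangents. This is Young's inequality for
  \<open>\<bar>b\<bar> * a powr (r - 1)\<close> with the conjugate exponents \<open>r\<close> and \<open>r / (r - 1)\<close>, so no differentiability
  at the kink of the absolute value has to be discussed.
\<close>

lemma powr_tangent_nonneg:
  fixes a b :: real
  assumes r: "1 < r" and a: "0 \<le> a"
  shows "a powr r + r * signed_power (r - 1) a * (b - a) \<le> \<bar>b\<bar> powr r"
proof -
  define q where "q = r / (r - 1)"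
  have q: "1 < q" "1 / r + 1 / q = 1"
    using r by (simp_all add: q_def field_simps)
  have pow: "(a powr (r - 1)) powr q = a powr r"
    using r by (simp add: q_def powr_powr)
  have "\<bar>b\<bar> * a powr (r - 1) \<le> \<bar>b\<bar> powr r / r + (a powr (r - 1)) powr q / q"
    using r q by (intro Youngs_inequality) auto
  also have "\<dots> = (\<bar>b\<bar> powr r + (r - 1) * a powr r) / r"
    unfolding pow using r by (simp add: q_def field_simps)
  finally have young: "r * (\<bar>b\<bar> * a powr (r - 1)) \<le> \<bar>b\<bar> powr r + (r - 1) * a powr r"
    using r by (simp add: field_simps)
  have "r * (b * a powr (r - 1)) \<le> r * (\<bar>b\<bar> * a powr (r - 1))"
    using r by (intro mult_left_mono mult_right_mono) auto
  moreover have "a powr (r - 1) * a = a powr r"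
    using r a by (cases "a = 0") (simp_all add: powr_diff)
  moreover have "signed_power (r - 1) a = a powr (r - 1)"
    using r a by (simp add: signed_power_def max_def)
  ultimately show ?thesis
    using young by (simp add: algebra_simps)
qed

lemma powr_tangent:
  fixes a b :: real
  assumes r: "1 < r"
  shows "\<bar>a\<bar> powr r + r * signed_power (r - 1) a * (b - a) \<le> \<bar>b\<bar> powr r"
proof (cases "0 \<le> a")
  case True
  then show ?thesis using powr_tangent_nonneg[OF r, of a b] by simp
next
  case False
  then show ?thesis using powr_tangent_nonneg[OF r, of "- a" "- b"]
    by (simp add: signed_power_minus algebra_simps)
qed

lemma sum_signed_power_strict_mono:
  fixes y z :: "'i \<Rightarrow> real"
  assumes "0 < q" "finite I" "I \<noteq> {}" "\<And>i. i \<in> I \<Longrightarrow> x - y i < x' - z i"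
  shows "(\<Sum>i\<in>I. signed_power q (x - y i)) < (\<Sum>i\<in>I. signed_power q (x' - z i))"
  using assms by (intro sum_strict_mono) (auto dest: strict_monoD[OF strict_mono_signed_power])

text \<open>
  The first-order condition for the minimizer, through which every property of the $p$-mean for
  finite exponent is derived. The left-hand side as a function of the point is strictly increasing
  and continuous and changes sign between the extreme values of the family, so it has a zero; the
  tangent inequality makes this zero the unique minimizer.
\<close>

lemma p_mean_stationary:
  fixes y :: "'i \<Rightarrow> real"
  assumes r: "1 < r" and fin: "finite I" and ne: "I \<noteq> {}"
  shows "(\<Sum>i\<in>I. signed_power (r - 1) (p_mean (ereal r) I y - y i)) = 0"
proof -
  define F where "F = (\<lambda>x. \<Sum>i\<in>I. \<bar>x - y i\<bar> powr r)"
  define S where "S = (\<lambda>x. \<Sum>i\<in>I. signed_power (r - 1) (x - y i))"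
  have q: "0 < r - 1" using r by simp
  have mono: "S x < S x'" if "x < x'" for x x'
    unfolding S_def using that by (intro sum_signed_power_strict_mono q fin ne) auto
  have tangent: "F x + r * S x * (x' - x) \<le> F x'" for x x'
  proof -
    have "F x + r * S x * (x' - x)
        = (\<Sum>i\<in>I. \<bar>x - y i\<bar> powr r + r * signed_power (r - 1) (x - y i) * ((x' - y i) - (x - y i)))"
      by (simp add: F_def S_def sum.distrib sum_distrib_left sum_distrib_right)
    also have "\<dots> \<le> F x'"
      unfolding F_def by (intro sum_mono powr_tangent r)
    finally show ?thesis .
  qed
  have le: "Min (y ` I) \<le> Max (y ` I)"
    using fin ne by (meson Max_ge Min_in finite_imageI image_is_empty)
  have "S (Min (y ` I)) \<le> 0"
    unfolding S_def
  proof (rule sum_nonpos)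
    fix i assume "i \<in> I"
    then have "Min (y ` I) - y i \<le> 0" using fin by simp
    then show "signed_power (r - 1) (Min (y ` I) - y i) \<le> 0"
      using strict_mono_less_eq[OF strict_mono_signed_power[OF q], of _ 0] by simp
  qed
  moreover have "0 \<le> S (Max (y ` I))"
    unfolding S_def
  proof (rule sum_nonneg)
    fix i assume "i \<in> I"
    then have "0 \<le> Max (y ` I) - y i" using fin by simp
    then show "0 \<le> signed_power (r - 1) (Max (y ` I) - y i)"
      using strict_mono_less_eq[OF strict_mono_signed_power[OF q], of 0] by simp
  qed
  moreover have "continuous_on {Min (y ` I)..Max (y ` I)} S"
    unfolding S_def by (intro continuous_intros q)
  ultimately obtain m where m: "S m = 0"
    using IVT'[of S "Min (y ` I)" 0 "Max (y ` I)"] le by blast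
  have min_m: "F m \<le> F x" for x
    using tangent[of m x] m by simp
  have uniq: "x = m" if "F x \<le> F m" for x
  proof (rule ccontr)
    assume "x \<noteq> m"
    \<comment> \<open>The tangent inequality is not strict, so comparing \<open>x\<close> with \<open>m\<close> directly gives nothing. At the
        midpoint the slope is nonzero and points towards \<open>x\<close>, whence \<open>F m \<le> F z < F x\<close>.\<close>
    define z where "z = (x + m) / 2"
    have "0 < S z * (x - z)"
    proof (cases "m < x")
      case True
      then have "m < z" "z < x" by (simp_all add: z_def)
      then show ?thesis using mono[of m z] m by simp
    next
      case False
      then have "z < m" "x < z" using \<open>x \<noteq> m\<close> by (simp_all add: z_def)
      then show ?thesis using mono[of z m] m by (simp add: mult_neg_neg)
    qed
    then have "0 < r * S z * (x - z)" using r by (simp add: mult.assoc)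
    then have "F z < F x" using tangent[of z x] by linarith
    then show False using min_m[of z] that by linarith
  qed
  have "p_mean (ereal r) I y = (THE x. is_arg_min F (\<lambda>_. True) x)"
    by (simp add: p_mean_def F_def)
  also have "\<dots> = m"
  proof (rule the_equality)
    show "is_arg_min F (\<lambda>_. True) m"
      using min_m by (auto simp: is_arg_min_def not_less)
    show "x = m" if "is_arg_min F (\<lambda>_. True) x" for x
      using that uniq by (auto simp: is_arg_min_def not_less)
  qed
  finally show ?thesis using m by (simp add: S_def)
qed

text \<open>
  Monotonicity and translation equivariance in one statement. For finite exponent, if the left-hand
  side were larger, all deviations from it would exceed those from the other mean, so the two sums of
  signed powers could not both vanish.
\<close>

lemma p_mean_le_add:
  fixes y z :: "'i \<Rightarrow> real"
  assumes p: "1 < p" and fin: "finite I" and ne: "I \<noteq> {}"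
    and le: "\<And>i. i \<in> I \<Longrightarrow> y i \<le> z i + c"
  shows "p_mean p I y \<le> p_mean p I z + c"
proof (cases p)
  case (real r)
  then have r: "1 < r" using p by simp
  show ?thesis
  proof (rule ccontr)
    assume "\<not> ?thesis"
    then have "p_mean p I z - z i < p_mean p I y - y i" if "i \<in> I" for i
      using le[OF that] by linarith
    then have "(\<Sum>i\<in>I. signed_power (r - 1) (p_mean p I z - z i))
        < (\<Sum>i\<in>I. signed_power (r - 1) (p_mean p I y - y i))"
      using r by (intro sum_signed_power_strict_mono fin ne) auto
    then show False
      using p_mean_stationary[OF r fin ne] real by simp
  qed
next
  case PInf
  have "Max (y ` I) \<le> Max (z ` I) + c"
  proof -
    obtain i where "i \<in> I" "Max (y ` I) = y i"
      using obtains_MAX[OF fin ne] .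
    moreover have "z i \<le> Max (z ` I)" using \<open>i \<in> I\<close> fin by simp
    ultimately show ?thesis using le by force
  qed
  moreover have "Min (y ` I) \<le> Min (z ` I) + c"
  proof -
    obtain i where "i \<in> I" "Min (z ` I) = z i"
      using obtains_MIN[OF fin ne] .
    moreover have "Min (y ` I) \<le> y i" using \<open>i \<in> I\<close> fin by simp
    ultimately show ?thesis using le by force
  qed
  ultimately show ?thesis using PInf by (simp add: p_mean_def field_simps)
qed (use p in simp)

lemma p_mean_nonexpansive:
  fixes y z :: "'i \<Rightarrow> real"
  assumes "1 < p" "finite I" "I \<noteq> {}" and le: "\<And>i. i \<in> I \<Longrightarrow> \<bar>y i - z i\<bar> \<le> c"
  shows "\<bar>p_mean p I y - p_mean p I z\<bar> \<le> c"
proof -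
  have "y i \<le> z i + c" "z i \<le> y i + c" if "i \<in> I" for i
    using le[OF that] by linarith+
  then have "p_mean p I y \<le> p_mean p I z + c" "p_mean p I z \<le> p_mean p I y + c"
    using assms by (auto intro!: p_mean_le_add)
  then show ?thesis by linarith
qed

text \<open>
  The strict part of internality, needed for the maximum principle: at a mean above all
  arguments the terms of the first-order condition are nonnegative, hence all zero; for \<open>p = \<infinity>\<close> a
  midpoint can only reach the maximum if the minimum does too.
\<close>

lemma p_mean_eq_upper_bound:
  fixes y :: "'i \<Rightarrow> real"
  assumes p: "1 < p" and fin: "finite I" and i: "i \<in> I"
    and ub: "\<And>i. i \<in> I \<Longrightarrow> y i \<le> p_mean p I y"
  shows "y i = p_mean p I y"
proof (cases p)
  case (real r)
  then have r: "1 < r" using p by simp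
  have mono: "strict_mono (signed_power (r - 1))"
    using r by (intro strict_mono_signed_power) simp
  have nonneg: "0 \<le> signed_power (r - 1) (p_mean p I y - y j)" if "j \<in> I" for j
    using ub[OF that] strict_mono_less_eq[OF mono, of 0] by simp
  have "(\<Sum>j\<in>I. signed_power (r - 1) (p_mean p I y - y j)) = 0"
    using p_mean_stationary[OF r fin] i real by auto
  then have "signed_power (r - 1) (p_mean p I y - y i) = signed_power (r - 1) 0"
    using sum_nonneg_eq_0_iff[OF fin nonneg] i by simp
  then have "p_mean p I y - y i = 0" using strict_mono_eq[OF mono] by blast
  then show ?thesis by simp
next
  case PInf
  have ne: "y ` I \<noteq> {}" "finite (y ` I)" using fin i by auto
  have "Max (y ` I) \<le> p_mean p I y" using ne ub by auto
  then have "p_mean p I y \<le> Min (y ` I)" using PInf by (simp add: p_mean_def)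
  moreover have "Min (y ` I) \<le> y i" using fin i by simp
  ultimately show ?thesis using ub[OF i] by linarith
qed (use p in simp)

section \<open>Neighbourhoods and the maximum principle\<close>

lemma (in pair_graph) nbrs_subset: "nbrs G u \<subseteq> pverts G"
  by (auto simp: nbrs_def dest: in_arcsD2)

lemma (in pair_graph) finite_nbrs: "finite (nbrs G u)"
  using nbrs_subset pair_finite_verts by (rule finite_subset)

lemma (in pair_graph) card_nbrs_le_max_degree:
  assumes "u \<in> pverts G"
  shows "card (nbrs G u) \<le> max_degree G"
proof -
  have "out_arcs (with_proj G) u = Pair u ` nbrs G u"
    by (auto simp: Digraph.out_arcs_def nbrs_def)
  then have "out_degree (with_proj G) u = card (nbrs G u)"
    by (simp add: Digraph.out_degree_def card_image inj_on_def)
  moreover have "out_degree (with_proj G) u \<le> max_degree G"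
    unfolding max_degree_def using assms pair_finite_verts by (intro Max_ge) auto
  ultimately show ?thesis by simp
qed

lemma (in pair_graph) connected_arcs_rtrancl:
  assumes "Digraph_Component.connected (with_proj G)" "u \<in> pverts G" "v \<in> pverts G"
  shows "(u, v) \<in> (parcs G)\<^sup>*"
proof -
  have "strongly_connected (with_proj G)"
    using symmetric_connected_imp_strongly_connected[OF pair_sym_arcs] assms(1) by simp
  then have "u \<rightarrow>\<^sup>*\<^bsub>with_proj G\<^esub> v"
    using assms(2,3) by (auto simp: strongly_connected_def)
  then show ?thesis
    using reachable_conv by auto
qed

lemma (in pair_graph) nbrs_nonempty:
  assumes "Digraph_Component.connected (with_proj G)" "2 \<le> card (pverts G)" "u \<in> pverts G"
  shows "nbrs G u \<noteq> {}"
proof -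
  obtain v where "v \<in> pverts G" "v \<noteq> u"
  proof -
    have "pverts G \<noteq> {u}" using assms(2) by auto
    then show ?thesis using that assms(3) by blast
  qed
  then have "(u, v) \<in> (parcs G)\<^sup>*" "u \<noteq> v"
    using connected_arcs_rtrancl[OF assms(1,3)] by auto
  then show ?thesis
    by (auto simp: nbrs_def elim: converse_rtranclE)
qed

text \<open>The set where the maximum is attained is closed under taking neighbours.\<close>

lemma (in pair_graph) harmonic_imp_constant:
  fixes f :: "'a \<Rightarrow> real"
  assumes conn: "Digraph_Component.connected (with_proj G)" and p: "1 < p"
    and harm: "\<And>u. u \<in> pverts G \<Longrightarrow> sync_update G p f u = f u"
  shows "f constant_on pverts G"
proof (cases "pverts G = {}")
  case False
  define c where "c = Max (f ` pverts G)"
  obtain a where a: "a \<in> pverts G" "f a = c"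
    using obtains_MAX[OF pair_finite_verts False, of f] unfolding c_def by metis
  have le: "f v \<le> c" if "v \<in> pverts G" for v
    using that pair_finite_verts by (simp add: c_def)
  have "f v = c" if "v \<in> pverts G" for v
  proof -
    have "(a, v) \<in> (parcs G)\<^sup>*"
      using connected_arcs_rtrancl[OF conn a(1) that] .
    then show ?thesis
    proof (induction rule: rtrancl_induct)
      case base
      then show ?case by (rule a(2))
    next
      case (step u v)
      then have u: "u \<in> pverts G" and v: "v \<in> nbrs G u"
        by (auto simp: nbrs_def dest: in_arcsD1)
      have mean: "p_mean p (nbrs G u) f = c"
        using harm[OF u] step.IH by (simp add: sync_update_def)
      have "f v = p_mean p (nbrs G u) f"
        using le nbrs_subset by (intro p_mean_eq_upper_bound p finite_nbrs v) (auto simp: mean)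
      then show ?case using mean by simp
    qed
  qed
  then show ?thesis by (auto simp: constant_on_def)
qed (simp add: constant_on_def)

section \<open>Domination of displacements by influence depth\<close>

text \<open>
  The influence depth, a last-passage quantity: for a graph without isolated vertices, the largest \<open>j\<close> for which there are times
  \<open>1 \<le> t\<^sub>1 < \<dots> < t\<^sub>j \<le> t\<close> with consecutive \<open>w t\<^sub>i\<close> adjacent and \<open>w t\<^sub>j\<close> the given vertex. Keeping the old
  value as a candidate in the maximum makes it nondecreasing in time, so that a bound at a final
  time controls all earlier times at once.
\<close>

primrec depth :: "'a pair_pre_digraph \<Rightarrow> (nat \<Rightarrow> 'a) \<Rightarrow> nat \<Rightarrow> 'a \<Rightarrow> nat" where
  "depth G w 0 = (\<lambda>_. 0)"
| "depth G w (Suc t) = (depth G w t)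
     (w (Suc t) := Max (insert (depth G w t (w (Suc t)))
                              ((\<lambda>v. Suc (depth G w t v)) ` nbrs G (w (Suc t)))))"

lemma depth_cong:
  assumes "\<And>s. s \<in> {1..t} \<Longrightarrow> w s = w' s"
  shows "depth G w t = depth G w' t"
  using assms by (induction t) auto

context pair_graph
begin

lemma depth_Suc_ge_nbr:
  assumes "v \<in> nbrs G (w (Suc t))"
  shows "Suc (depth G w t v) \<le> depth G w (Suc t) (w (Suc t))"
  using assms finite_nbrs by simp

lemma depth_mono:
  assumes "s \<le> t"
  shows "depth G w s u \<le> depth G w t u"
  using assms
proof (induction t rule: dec_induct)
  case (step t)
  have "depth G w t u \<le> depth G w (Suc t) u"
    using finite_nbrs by simp
  with step.IH show ?case by linarith
qed simp

lemma depth_le_time: "depth G w t u \<le> t"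
proof (induction t arbitrary: u)
  case (Suc t)
  have "depth G w t v \<le> Suc t" for v using Suc.IH[of v] by simp
  then show ?case
    using finite_nbrs Suc.IH by simp
qed simp

text \<open>
  Comparing the update at time \<open>t\<close> with the synchronous update of the initial profile, nonexpansiveness
  passes on the displacements of the neighbours and the initial defect adds at most \<open>\<psi>\<close>.
\<close>

lemma displacement_le_depth:
  assumes p: "1 < p" and ne: "\<And>u. u \<in> pverts G \<Longrightarrow> nbrs G u \<noteq> {}"
    and psi: "\<And>u. u \<in> pverts G \<Longrightarrow> \<bar>sync_update G p f u - f u\<bar> \<le> \<psi>"
    and w: "\<And>t. 1 \<le> t \<Longrightarrow> w t \<in> pverts G" and u: "u \<in> pverts G"
  shows "\<bar>trajectory G p f w t u - f u\<bar> \<le> \<psi> * real (depth G w t u)"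
  using u
proof (induction t arbitrary: u)
  case (Suc t)
  define a where "a = w (Suc t)"
  have a: "a \<in> pverts G" using w by (simp add: a_def)
  have psi0: "0 \<le> \<psi>" using psi[OF a] by linarith
  show ?case
  proof (cases "u = a")
    case False
    then show ?thesis using Suc by (simp add: vertex_update_def a_def)
  next
    case True
    define d where "d = depth G w (Suc t) a"
    have "\<bar>trajectory G p f w t v - f v\<bar> \<le> \<psi> * (real d - 1)" if "v \<in> nbrs G a" for v
    proof -
      have "real (depth G w t v) \<le> real d - 1"
        using depth_Suc_ge_nbr[of v w t] that by (simp add: a_def d_def del: depth.simps)
      then have "\<psi> * real (depth G w t v) \<le> \<psi> * (real d - 1)"
        using psi0 by (intro mult_left_mono)
      moreover have "v \<in> pverts G" using that nbrs_subset by auto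
      ultimately show ?thesis using Suc.IH[of v] by linarith
    qed
    then have "\<bar>p_mean p (nbrs G a) (trajectory G p f w t) - sync_update G p f a\<bar> \<le> \<psi> * (real d - 1)"
      unfolding sync_update_def by (intro p_mean_nonexpansive p finite_nbrs ne a)
    moreover have "trajectory G p f w (Suc t) u = p_mean p (nbrs G a) (trajectory G p f w t)"
      by (simp add: True a_def vertex_update_def)
    ultimately have "\<bar>trajectory G p f w (Suc t) u - f u\<bar> \<le> \<psi> * (real d - 1) + \<psi>"
      using psi[OF a] arg_cong[OF True, of f] by linarith
    then show ?thesis by (simp add: True d_def algebra_simps)
  qed
qed simp

lemma hit_time_gt:
  assumes p: "1 < p" and ne: "\<And>u. u \<in> pverts G \<Longrightarrow> nbrs G u \<noteq> {}"
    and psi: "\<And>u. u \<in> pverts G \<Longrightarrow> \<bar>sync_update G p f u - f u\<bar> \<le> \<psi>" and psi_pos: "0 < \<psi>"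
    and w: "\<And>t. 1 \<le> t \<Longrightarrow> w t \<in> pverts G"
    and a: "a \<in> pverts G" and b: "b \<in> pverts G"
    and depth_a: "4 * \<psi> * real (depth G w T a) < f a - f b"
    and depth_b: "4 * \<psi> * real (depth G w T b) < f a - f b"
    and eps: "\<epsilon> \<le> (f a - f b) / 2"
  shows "enat (Suc T) \<le> hit_time G p \<epsilon> f w"
proof -
  have big: "\<epsilon> < osc (pverts G) (trajectory G p f w t)" if "t \<le> T" for t
  proof -
    define g where "g = trajectory G p f w t"
    have disp: "\<bar>g v - f v\<bar> \<le> \<psi> * real (depth G w T v)" if "v \<in> pverts G" for v
    proof -
      have "\<psi> * real (depth G w t v) \<le> \<psi> * real (depth G w T v)"
        using depth_mono[OF \<open>t \<le> T\<close>] psi_pos by (intro mult_left_mono) auto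
      moreover have "\<bar>g v - f v\<bar> \<le> \<psi> * real (depth G w t v)"
        unfolding g_def by (rule displacement_le_depth[OF p ne psi w that])
      ultimately show ?thesis by linarith
    qed
    have "(f a - f b) / 2 < g a - g b"
      using disp[OF a] disp[OF b] depth_a depth_b by (simp add: abs_le_iff)
    moreover have "g a \<le> Max (g ` pverts G)" "Min (g ` pverts G) \<le> g b"
      using a b pair_finite_verts by auto
    ultimately show ?thesis using eps by (simp add: osc_def g_def)
  qed
  show ?thesis
  proof (cases "\<exists>t. osc (pverts G) (trajectory G p f w t) \<le> \<epsilon>")
    case True
    then have "osc (pverts G) (trajectory G p f w (LEAST t. osc (pverts G) (trajectory G p f w t) \<le> \<epsilon>)) \<le> \<epsilon>"
      by (rule LeastI_ex)
    then have "\<not> (LEAST t. osc (pverts G) (trajectory G p f w t) \<le> \<epsilon>) \<le> T"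
      using big by force
    then show ?thesis using True by (simp add: hit_time_def)
  qed (simp add: hit_time_def)
qed

text \<open>
  The maximum that defines the new depth is replaced by the sum over all its candidates. This makes
  the recursion linear in the powers, which is what an expectation can be taken of.
\<close>

lemma power_depth_Suc_le:
  fixes x :: real
  assumes "0 \<le> x"
  shows "x ^ depth G w (Suc t) u \<le> x ^ depth G w t u +
    (\<Sum>v\<in>nbrs G u. x * (x ^ depth G w t v * indicator {u} (w (Suc t))))"
proof (cases "w (Suc t) = u")
  case True
  define A where "A = insert (depth G w t u) ((\<lambda>v. Suc (depth G w t v)) ` nbrs G u)"
  have nonneg: "0 \<le> x * x ^ depth G w t v" for v using assms by simp
  have "Max A \<in> A" unfolding A_def using finite_nbrs by (intro Max_in) auto
  then consider "Max A = depth G w t u"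
    | v where "v \<in> nbrs G u" "Max A = Suc (depth G w t v)"
    unfolding A_def by auto
  then have "x ^ Max A \<le> x ^ depth G w t u + (\<Sum>v\<in>nbrs G u. x * x ^ depth G w t v)"
  proof cases
    case 1
    then show ?thesis using nonneg by (simp add: sum_nonneg)
  next
    case 2
    have "x * x ^ depth G w t v \<le> (\<Sum>v\<in>nbrs G u. x * x ^ depth G w t v)"
      using 2(1) nonneg by (intro member_le_sum finite_nbrs) auto
    then show ?thesis using 2 assms by (simp add: add_increasing)
  qed
  then show ?thesis using True by (simp add: A_def)
qed simp

end

section \<open>Exponential moments of the influence depth\<close>

text \<open>
  A function \<open>g\<close> that reads only the first \<open>t\<close> updates is measurable here, since the product of
  finitely many finite discrete spaces is discrete.
\<close>

lemma (in prob_space) indep_past_next: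
  fixes U :: "nat \<Rightarrow> 'a \<Rightarrow> 'v" and g :: "(nat \<Rightarrow> 'v) \<Rightarrow> real"
  assumes fin: "finite V"
    and indep: "indep_vars (\<lambda>_. count_space V) U {1..}"
    and uniform: "\<And>t. 1 \<le> t \<Longrightarrow> distr M (count_space V) (U t) = uniform_count_measure V"
    and past: "\<And>w. g w = g (restrict w {1..t})" and bdd: "\<And>w. \<bar>g w\<bar> \<le> B"
    and u: "u \<in> V"
  shows integrable_past: "integrable M (\<lambda>\<omega>. g (\<lambda>s. U s \<omega>))"
    and integrable_past_next:
      "integrable M (\<lambda>\<omega>. g (\<lambda>s. U s \<omega>) * indicator {u} (U (Suc t) \<omega>))"
    and expectation_past_next:
      "expectation (\<lambda>\<omega>. g (\<lambda>s. U s \<omega>) * indicator {u} (U (Suc t) \<omega>))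
        = expectation (\<lambda>\<omega>. g (\<lambda>s. U s \<omega>)) / real (card V)"
proof -
  let ?P = "\<lambda>I. PiM I (\<lambda>_. count_space V)"
  have rv: "U s \<in> measurable M (count_space V)" if "1 \<le> s" for s
    using indep that by (auto simp: indep_vars_def)
  have ind: "indep_var (?P {1..t}) (\<lambda>\<omega>. restrict (\<lambda>s. U s \<omega>) {1..t})
      (?P {Suc t}) (\<lambda>\<omega>. restrict (\<lambda>s. U s \<omega>) {Suc t})"
    using indep by (rule indep_var_restrict) auto
  have "?P {1..t} = count_space ({1..t} \<rightarrow>\<^sub>E V)"
    using fin by (intro count_space_PiM_finite) (auto intro: countable_finite)
  then have g: "g \<in> borel_measurable (?P {1..t})" by simp
  have "(\<lambda>w. w (Suc t)) \<in> measurable (?P {Suc t}) (count_space V)"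
    by (rule measurable_component_singleton) simp
  then have h: "(\<lambda>w. indicator {u} (w (Suc t)) :: real) \<in> borel_measurable (?P {Suc t})"
    by (rule measurable_compose) simp
  have ind': "indep_var borel (\<lambda>\<omega>. g (\<lambda>s. U s \<omega>)) borel (\<lambda>\<omega>. indicator {u} (U (Suc t) \<omega>) :: real)"
    using indep_var_compose[OF ind g h] past[of "\<lambda>s. U s _"] by (simp add: comp_def)
  show int_g: "integrable M (\<lambda>\<omega>. g (\<lambda>s. U s \<omega>))"
    using indep_var_rv1[OF ind'] bdd
    by (intro integrable_const_bound[where B=B]) auto
  have int_h: "integrable M (\<lambda>\<omega>. indicator {u} (U (Suc t) \<omega>) :: real)"
    using indep_var_rv2[OF ind']
    by (intro integrable_const_bound[where B=1]) (auto simp: indicator_def)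
  show "integrable M (\<lambda>\<omega>. g (\<lambda>s. U s \<omega>) * indicator {u} (U (Suc t) \<omega>))"
    by (rule indep_var_integrable[OF ind' int_g int_h])
  have "expectation (\<lambda>\<omega>. indicator {u} (U (Suc t) \<omega>) :: real)
      = integral\<^sup>L (distr M (count_space V) (U (Suc t))) (indicator {u})"
    using rv by (subst integral_distr) auto
  also have "\<dots> = measure (uniform_count_measure V) {u}"
    using uniform u by (simp add: space_uniform_count_measure)
  also have "\<dots> = 1 / real (card V)"
    using fin u by (simp add: measure_uniform_count_measure)
  finally show "expectation (\<lambda>\<omega>. g (\<lambda>s. U s \<omega>) * indicator {u} (U (Suc t) \<omega>))
        = expectation (\<lambda>\<omega>. g (\<lambda>s. U s \<omega>)) / real (card V)"
    using indep_var_lebesgue_integral[OF ind' int_g int_h] by simp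
qed

context
  fixes G :: "'v pair_pre_digraph" and M :: "'b measure" and U :: "nat \<Rightarrow> 'b \<Rightarrow> 'v"
  assumes graph: "pair_graph G" and prob: "prob_space M"
    and indep: "prob_space.indep_vars M (\<lambda>_. count_space (pverts G)) U {1..}"
    and uniform: "\<And>t. t \<ge> 1 \<Longrightarrow>
      distr M (count_space (pverts G)) (U t) = uniform_count_measure (pverts G)"
begin

interpretation pair_graph G by (rule graph)
interpretation prob_space M by (rule prob)

lemma expectation_power_depth_Suc:
  fixes x :: real
  assumes x: "1 \<le> x" and u: "u \<in> pverts G"
  shows "integrable M (\<lambda>\<omega>. x ^ depth G (\<lambda>s. U s \<omega>) t v)"
    and "integrable M (\<lambda>\<omega>. x ^ depth G (\<lambda>s. U s \<omega>) t v * indicator {u} (U (Suc t) \<omega>))"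
    and "expectation (\<lambda>\<omega>. x ^ depth G (\<lambda>s. U s \<omega>) t v * indicator {u} (U (Suc t) \<omega>))
        = expectation (\<lambda>\<omega>. x ^ depth G (\<lambda>s. U s \<omega>) t v) / real (card (pverts G))"
proof -
  have past: "x ^ depth G w t v = x ^ depth G (restrict w {1..t}) t v" for w
    using depth_cong[of t w "restrict w {1..t}" G] by simp
  have bdd: "\<bar>x ^ depth G w t v\<bar> \<le> x ^ t" for w
    using x depth_le_time by (simp add: power_increasing)
  note * = indep_past_next[where g = "\<lambda>w. x ^ depth G w t v",
      OF pair_finite_verts indep uniform past bdd u]
  show "integrable M (\<lambda>\<omega>. x ^ depth G (\<lambda>s. U s \<omega>) t v)"
    and "integrable M (\<lambda>\<omega>. x ^ depth G (\<lambda>s. U s \<omega>) t v * indicator {u} (U (Suc t) \<omega>))"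
    and "expectation (\<lambda>\<omega>. x ^ depth G (\<lambda>s. U s \<omega>) t v * indicator {u} (U (Suc t) \<omega>))
        = expectation (\<lambda>\<omega>. x ^ depth G (\<lambda>s. U s \<omega>) t v) / real (card (pverts G))"
    by (rule *; simp)+
qed

lemma expectation_power_depth_le:
  fixes x :: real
  assumes x: "1 \<le> x" and u: "u \<in> pverts G"
  shows "expectation (\<lambda>\<omega>. x ^ depth G (\<lambda>s. U s \<omega>) t u)
    \<le> (1 + x * real (max_degree G) / real (card (pverts G))) ^ t"
  using u
proof (induction t arbitrary: u)
  case 0
  then show ?case by (simp add: prob_space)
next
  case (Suc t)
  define n where "n = real (card (pverts G))"
  define c where "c = (1 + x * real (max_degree G) / n) ^ t"
  define X where "X = (\<lambda>v \<omega>. x ^ depth G (\<lambda>s. U s \<omega>) t v)"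
  have moments: "integrable M (X v)"
      "integrable M (\<lambda>\<omega>. X v \<omega> * indicator {u} (U (Suc t) \<omega>))"
      "expectation (\<lambda>\<omega>. X v \<omega> * indicator {u} (U (Suc t) \<omega>)) = expectation (X v) / n" for v
    unfolding X_def n_def by (rule expectation_power_depth_Suc[OF x Suc.prems])+
  have n: "0 < n" using Suc.prems pair_finite_verts by (auto simp: n_def card_gt_0_iff)
  have c: "0 \<le> c" using x n by (simp add: c_def)
  have IH: "expectation (X v) \<le> c" if "v \<in> pverts G" for v
    using Suc.IH[OF that] by (simp add: X_def c_def n_def)
  have "expectation (\<lambda>\<omega>. x ^ depth G (\<lambda>s. U s \<omega>) (Suc t) u)
      \<le> expectation (\<lambda>\<omega>. X u \<omega> + (\<Sum>v\<in>nbrs G u. x * (X v \<omega> * indicator {u} (U (Suc t) \<omega>))))"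
  proof (rule integral_mono)
    show "integrable M (\<lambda>\<omega>. x ^ depth G (\<lambda>s. U s \<omega>) (Suc t) u)"
      using expectation_power_depth_Suc(1)[OF x Suc.prems] .
    show "integrable M (\<lambda>\<omega>. X u \<omega> + (\<Sum>v\<in>nbrs G u. x * (X v \<omega> * indicator {u} (U (Suc t) \<omega>))))"
      using moments by (intro Bochner_Integration.integrable_add Bochner_Integration.integrable_sum
          integrable_mult_right) auto
    show "x ^ depth G (\<lambda>s. U s \<omega>) (Suc t) u
        \<le> X u \<omega> + (\<Sum>v\<in>nbrs G u. x * (X v \<omega> * indicator {u} (U (Suc t) \<omega>)))" for \<omega>
      unfolding X_def using x by (intro power_depth_Suc_le) simp
  qed
  also have "\<dots> = expectation (X u) + (\<Sum>v\<in>nbrs G u. x * (expectation (X v) / n))"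
    using moments by simp
  also have "\<dots> \<le> c + (\<Sum>v\<in>nbrs G u. x * (c / n))"
    using IH Suc.prems nbrs_subset[of u] x n
    by (intro add_mono sum_mono mult_left_mono divide_right_mono) auto
  also have "\<dots> = c + real (card (nbrs G u)) * (x * (c / n))"
    by simp
  also have "\<dots> \<le> c + real (max_degree G) * (x * (c / n))"
    using card_nbrs_le_max_degree[OF Suc.prems] x n c
    by (intro add_left_mono mult_right_mono) auto
  also have "\<dots> = (1 + x * real (max_degree G) / n) ^ Suc t"
    by (simp add: c_def algebra_simps)
  finally show ?case by (simp add: n_def)
qed

text \<open>
  Chernoff's method with base \<open>x = 4 e\<close>: the moment is at most \<open>exp (x \<Delta> T / n) \<le> exp k\<close>, and
  \<open>exp k / x\<^bsup>k\<^esup> = 4\<^bsup>-k\<^esup>\<close>.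
\<close>

lemma prob_depth_ge_le:
  assumes u: "u \<in> pverts G"
    and T: "4 * exp 1 * real (max_degree G) * real T \<le> real k * real (card (pverts G))"
  shows "{\<omega> \<in> space M. k \<le> depth G (\<lambda>s. U s \<omega>) T u} \<in> events"
    and "prob {\<omega> \<in> space M. k \<le> depth G (\<lambda>s. U s \<omega>) T u} \<le> (1 / 4) ^ k"
proof -
  define n where "n = real (card (pverts G))"
  define x :: real where "x = 4 * exp 1"
  have n: "0 < n" using u pair_finite_verts by (auto simp: n_def card_gt_0_iff)
  have x: "1 < x"
    using exp_ge_add_one_self[of "1::real"] by (simp add: x_def)
  let ?X = "\<lambda>\<omega>. x ^ depth G (\<lambda>s. U s \<omega>) T u"
  have int: "integrable M ?X"
    using expectation_power_depth_Suc(1)[OF _ u] x by simp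
  have eq: "{\<omega> \<in> space M. k \<le> depth G (\<lambda>s. U s \<omega>) T u} = {\<omega> \<in> space M. x ^ k \<le> ?X \<omega>}"
    using x by (simp add: power_increasing_iff)
  have [measurable]: "?X \<in> borel_measurable M" using int by simp
  show "{\<omega> \<in> space M. k \<le> depth G (\<lambda>s. U s \<omega>) T u} \<in> events"
    unfolding eq by measurable
  have "prob {\<omega> \<in> space M. x ^ k \<le> ?X \<omega>} \<le> expectation ?X / x ^ k"
    using int x by (intro integral_Markov_inequality_measure[where A="space M"]) auto
  also have "expectation ?X \<le> (1 + x * real (max_degree G) / n) ^ T"
    using expectation_power_depth_le[OF _ u] x by (simp add: n_def)
  also have "\<dots> \<le> exp (x * real (max_degree G) / n) ^ T"
    using x n by (intro power_mono exp_ge_add_one_self) auto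
  also have "\<dots> = exp (real T * (x * real (max_degree G) / n))"
    by (rule exp_of_nat_mult[symmetric])
  also have "\<dots> \<le> exp (real k)"
    using T n by (simp add: x_def n_def field_simps)
  also have "exp (real k) / x ^ k = (1 / 4) ^ k"
    by (simp add: x_def power_mult_distrib exp_of_nat_mult[symmetric] power_divide)
  finally show "prob {\<omega> \<in> space M. k \<le> depth G (\<lambda>s. U s \<omega>) T u} \<le> (1 / 4) ^ k"
    unfolding eq using x by (simp add: divide_right_mono)
qed

end

section \<open>The lower bound\<close>

theorem theorem5p1:
  fixes G :: "'a pair_pre_digraph"
    and p :: ereal
    and f0 :: "'a \<Rightarrow> real"
    and M :: "'b measure"
    and U :: "nat \<Rightarrow> 'b \<Rightarrow> 'a"
    and R \<psi> :: real
  assumes graph: "pair_graph G"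
    and connected: "Digraph_Component.connected (with_proj G)"
    and card_ge_2: "card (pverts G) \<ge> 2"
    and p_gt_1: "1 < p"
    and nonconstant: "\<not> f0 constant_on pverts G"
    and prob: "prob_space M"
    and indep: "prob_space.indep_vars M (\<lambda>_. count_space (pverts G)) U {1..}"
    and uniform: "\<And>t. t \<ge> 1 \<Longrightarrow>
      distr M (count_space (pverts G)) (U t) = uniform_count_measure (pverts G)"
    and R_eq: "R = osc (pverts G) f0"
    and psi_eq: "\<psi> = sup_norm (pverts G) (\<lambda>u. sync_update G p f0 u - f0 u)"
  shows "\<psi> > 0 \<and>
    (\<forall>\<epsilon>. 0 < \<epsilon> \<and> \<epsilon> \<le> R / 2 \<longrightarrow>
      (\<integral>\<^sup>+ \<omega>. ennreal_of_enat (hit_time G p \<epsilon> f0 (\<lambda>t. U t \<omega>)) \<partial>M)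
        \<ge> ennreal (1 / (64 * exp 1) *
            (real (card (pverts G)) * R / (real (max_degree G) * \<psi>))))"
proof -
  interpret pair_graph G by (rule graph)
  interpret prob_space M by (rule prob)
  define n where "n = card (pverts G)"
  define \<Delta> where "\<Delta> = max_degree G"
  have fin: "finite (pverts G)" by (rule pair_finite_verts)
  have Vne: "pverts G \<noteq> {}" using card_ge_2 by auto
  have ne: "nbrs G u \<noteq> {}" if "u \<in> pverts G" for u
    by (rule nbrs_nonempty[OF connected card_ge_2 that])
  obtain a where a: "a \<in> pverts G" "f0 a = Max (f0 ` pverts G)"
    using obtains_MAX[OF fin Vne, of f0] by metis
  obtain b where b: "b \<in> pverts G" "f0 b = Min (f0 ` pverts G)"
    using obtains_MIN[OF fin Vne, of f0] by metis
  have R: "R = f0 a - f0 b" by (simp add: R_eq osc_def a b)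
  have range: "f0 b \<le> f0 v" "f0 v \<le> f0 a" if "v \<in> pverts G" for v
    using that fin by (simp_all add: a b)
  have R_pos: "0 < R"
  proof (rule ccontr)
    assume "\<not> 0 < R"
    then have "f0 v = f0 a" if "v \<in> pverts G" for v
      using range[OF that] R by linarith
    then show False using nonconstant by (auto simp: constant_on_def)
  qed
  have psi: "\<bar>sync_update G p f0 u - f0 u\<bar> \<le> \<psi>" if "u \<in> pverts G" for u
    unfolding psi_eq sup_norm_def using that fin by simp
  have psi_pos: "0 < \<psi>"
  proof (rule ccontr)
    assume "\<not> 0 < \<psi>"
    then have "sync_update G p f0 u = f0 u" if "u \<in> pverts G" for u
      using psi[OF that] by linarith
    then show False
      using harmonic_imp_constant[OF connected p_gt_1] nonconstant by blast
  qed
  have n_pos: "0 < n" using card_ge_2 by (simp add: n_def)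
  have \<Delta>_pos: "0 < \<Delta>"
  proof -
    have "0 < card (nbrs G a)" using ne[OF a(1)] finite_nbrs by (simp add: card_gt_0_iff)
    then show ?thesis using card_nbrs_le_max_degree[OF a(1)] by (simp add: \<Delta>_def)
  qed
  \<comment> \<open>\<open>k\<close> is the least depth that allows a displacement of \<open>R / 4\<close>, and \<open>T\<close> the last time at which the tail
      bound for depth \<open>k\<close> is available.\<close>
  define k where "k = nat \<lceil>R / (4 * \<psi>)\<rceil>"
  define T where "T = nat \<lfloor>real k * real n / (4 * exp 1 * real \<Delta>)\<rfloor>"
  have ratio: "0 < R / (4 * \<psi>)" using R_pos psi_pos by simp
  have k_ge: "R / (4 * \<psi>) \<le> real k"
    unfolding k_def by (rule real_nat_ceiling_ge)
  have k_pos: "1 \<le> k" using k_ge ratio by (cases k) auto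
  have small: "4 * \<psi> * real d < R" if "d < k" for d
  proof -
    have "real d < R / (4 * \<psi>)"
      using that ratio unfolding k_def by linarith
    then show ?thesis using psi_pos by (simp add: field_simps)
  qed
  have "real T \<le> real k * real n / (4 * exp 1 * real \<Delta>)"
    unfolding T_def by (intro of_nat_floor) simp
  then have T_le: "4 * exp 1 * real \<Delta> * real T \<le> real k * real n"
    using \<Delta>_pos by (simp add: field_simps)
  have T_gt: "real k * real n / (4 * exp 1 * real \<Delta>) \<le> real (Suc T)"
    unfolding T_def by linarith
  define bad where "bad = (\<lambda>v. {\<omega> \<in> space M. k \<le> depth G (\<lambda>s. U s \<omega>) T v})"
  have bad: "bad v \<in> events" "prob (bad v) \<le> 1 / 4" if "v \<in> pverts G" for v
  proof -
    show "bad v \<in> events"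
      unfolding bad_def
      by (rule prob_depth_ge_le(1)[OF graph prob indep uniform that T_le[unfolded n_def \<Delta>_def]])
    have "prob (bad v) \<le> (1 / 4) ^ k"
      unfolding bad_def
      by (rule prob_depth_ge_le(2)[OF graph prob indep uniform that T_le[unfolded n_def \<Delta>_def]])
    also have "(1 / 4 :: real) ^ k \<le> (1 / 4) ^ 1"
      using k_pos by (intro power_decreasing) auto
    finally show "prob (bad v) \<le> 1 / 4" by simp
  qed
  define good where "good = space M - (bad a \<union> bad b)"
  have bad_ev: "bad a \<union> bad b \<in> events" using bad(1)[OF a(1)] bad(1)[OF b(1)] by (rule sets.Un)
  then have good_ev: "good \<in> events" unfolding good_def by (rule sets.compl_sets)
  have "prob (bad a \<union> bad b) \<le> 1 / 4 + 1 / 4"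
    using measure_Un_le[OF bad(1)[OF a(1)] bad(1)[OF b(1)]] bad(2)[OF a(1)] bad(2)[OF b(1)]
    by linarith
  then have good_prob: "1 / 2 \<le> prob good"
    unfolding good_def prob_compl[OF bad_ev] by linarith
  have rv: "U t \<omega> \<in> pverts G" if "\<omega> \<in> space M" "1 \<le> t" for t \<omega>
  proof -
    have "U t \<in> measurable M (count_space (pverts G))"
      using indep that by (auto simp: indep_vars_def)
    from measurable_space[OF this that(1)] show ?thesis by simp
  qed
  have "ennreal (1 / (64 * exp 1) * (real (card (pverts G)) * R / (real (max_degree G) * \<psi>)))
      \<le> (\<integral>\<^sup>+ \<omega>. ennreal_of_enat (hit_time G p \<epsilon> f0 (\<lambda>t. U t \<omega>)) \<partial>M)"
    if eps: "0 < \<epsilon> \<and> \<epsilon> \<le> R / 2" for \<epsilon>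
  proof -
    have "1 / (64 * exp 1) * (real (card (pverts G)) * R / (real (max_degree G) * \<psi>))
        = (R / (4 * \<psi>)) * real n / (4 * exp 1 * real \<Delta>) * (1 / 4)"
      by (simp add: n_def \<Delta>_def field_simps)
    also have "\<dots> \<le> real k * real n / (4 * exp 1 * real \<Delta>) * (1 / 4)"
      using k_ge by (intro mult_right_mono divide_right_mono) auto
    \<comment> \<open>On the good event the oscillation is still large at time \<open>T\<close>, so the hitting time is at least
        \<open>T + 1\<close>; this compensates for the rounding in \<open>T\<close> and gives a bound even if \<open>T = 0\<close>.\<close>
    also have "\<dots> \<le> real (Suc T) * prob good"
      using T_gt good_prob by (intro mult_mono) auto
    finally have "ennreal (1 / (64 * exp 1) * (real (card (pverts G)) * R / (real (max_degree G) * \<psi>)))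
        \<le> ennreal (real (Suc T) * prob good)"
      by (rule ennreal_leI)
    also have "\<dots> = ennreal (real (Suc T)) * ennreal (prob good)"
      by (rule ennreal_mult) simp_all
    also have "\<dots> = (\<integral>\<^sup>+ \<omega>. ennreal (real (Suc T)) * indicator good \<omega> \<partial>M)"
      using good_ev by (simp add: nn_integral_cmult_indicator emeasure_eq_measure)
    also have "\<dots> \<le> (\<integral>\<^sup>+ \<omega>. ennreal_of_enat (hit_time G p \<epsilon> f0 (\<lambda>t. U t \<omega>)) \<partial>M)"
    proof (rule nn_integral_mono)
      fix \<omega> assume \<omega>: "\<omega> \<in> space M"
      show "ennreal (real (Suc T)) * indicator good \<omega>
          \<le> ennreal_of_enat (hit_time G p \<epsilon> f0 (\<lambda>t. U t \<omega>))"
      proof (cases "\<omega> \<in> good")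
        case True
        then have "depth G (\<lambda>s. U s \<omega>) T a < k" "depth G (\<lambda>s. U s \<omega>) T b < k"
          using \<omega> by (auto simp: good_def bad_def)
        then have "enat (Suc T) \<le> hit_time G p \<epsilon> f0 (\<lambda>t. U t \<omega>)"
          using small[of "depth G (\<lambda>s. U s \<omega>) T a"] small[of "depth G (\<lambda>s. U s \<omega>) T b"] eps
          by (intro hit_time_gt[OF p_gt_1 ne psi psi_pos rv[OF \<omega>] a(1) b(1)]) (simp_all add: R)
        then have "ennreal_of_enat (enat (Suc T)) \<le> ennreal_of_enat (hit_time G p \<epsilon> f0 (\<lambda>t. U t \<omega>))"
          by (simp only: ennreal_of_enat_le_iff)
        then show ?thesis using True by (simp add: ennreal_of_nat_eq_real_of_nat)
      qed simp
    qed
    finally show ?thesis .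
  qed
  then show ?thesis using psi_pos by blast
qed

end
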